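(* Let $\epsilon>0$, $p\in(0,1)$, $\mu_x,\mu_y,L_x,L_y,L_{xy},\ell_x,\ell_y>0$ with $\mu_x\le L_x$, $\mu_y\le L_y$, and set $$T=\left\lceil \log_{2}\left(\max\left(\frac{L_x}{\mu_x},\frac{L_y}{\mu_y},\frac{L_{xy}^2}{\mu_x\mu_y}\right)\right)\right\rceil,\quad \delta=\frac{\epsilon}{4+4T},\quad \lambda_x^i=\mu_x2^i,\ \lambda_y^i=\mu_y2^i\ (0\le i\le T),\quad \lambda_x^{-1}=\lambda_y^{-1}=0.$$ Then the total number of samples used by $\text{BoostSAA-C}(\delta,p,T)$ is bounded by $$\mathcal O\left(\ln^2(\kappa)\,\ln\left(\frac{\ln(\kappa)}{p}\right)\frac{\ell^2}{\mu\epsilon}\right).$$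
   Context: $\mu:=\min\{\mu_x,\mu_y\}$, $L:=\max\{L_x,L_y,L_{xy}\}$, $\ell:=\max\{\ell_x,\ell_y\}$, $\kappa:=L/\mu$. Here $\mu_x,\mu_y$ are the strong convexity/concavity moduli, $L_x,L_y,L_{xy}$ the gradient Lipschitz constants and $\ell_x,\ell_y$ the function Lipschitz constants of a stochastic saddle point problem $\min_{x\in\mathcal X}\max_{y\in\mathcal Y}\mathbb E[\Phi_\xi(x,y)]$ over compact convex sets. Sample usage of BoostSAA-C$(\delta,p,T)$: let $m$ be whichever of $\lceil18\ln(\frac{2T+6}{p})\rceil$, $\lceil18\ln(\frac{2T+6}{p})\rceil+1$ is odd. The total number of samples used is $$m\left(\sum_{i=0}^T(n_x^{i-1}+n_y^{i-1})+N_x+N_y+H_x+H_y\right),$$ where $n_x^{i-1}=\left\lceil\frac{54}{\delta}\left(\frac{\ell_x^2}{\mu_x+\lambda_x^{i-1}}+\frac{\ell_y^2}{\mu_y}\right)\right\rceil$, $n_y^{i-1}=\left\lceil\frac{54}{\delta}\left(\frac{\ell_x^2}{\mu_x}+\frac{\ell_y^2}{\mu_y+\lambda_y^{i-1}}\right)\right\rceil$ are the sample sizes of the sample average approximation (SAA) problems in rounds $i=0,\dots,T$; $N_x=\left\lceil\frac{6M_x^T}{\delta}\left(\frac{\ell_x^2}{\mu_x+\lambda_x^T}+\frac{\ell_y^2}{\mu_y}\right)\right\rceil$, $N_y=\left\lceil\frac{6M_y^T}{\delta}\left(\frac{\ell_x^2}{\mu_x}+\frac{\ell_y^2}{\mu_y+\lambda_y^T}\right)\right\rceil$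 are the SAA sample sizes of the last round; and $H_x=\left\lceil\frac{3M_x^T(\mu_x+\lambda_x^T)\sigma_x^2}{(L_x+\lambda_x^T)^2\delta}\right\rceil$, $H_y=\left\lceil\frac{3M_y^T(\mu_y+\lambda_y^T)\sigma_y^2}{(L_y+\lambda_y^T)^2\delta}\right\rceil$ are the sample sizes of the gradient estimators, with $\sigma_x^2=4\ell_x^2$, $\sigma_y^2=4\ell_y^2$, and $M_x^T:=3+(18\sqrt2+45)\frac{L_x+\lambda_x^T}{\mu_x+\lambda_x^T}+\frac{36L_{xy}}{\sqrt{(\mu_x+\lambda_x^T)\mu_y}}+\frac{9L_{xy}^2}{(\mu_x+\lambda_x^T)\mu_y}$, $M_y^T:=3+(18\sqrt2+45)\frac{L_y+\lambda_y^T}{\mu_y+\lambda_y^T}+\frac{36L_{xy}}{\sqrt{\mu_x(\mu_y+\lambda_y^T)}}+\frac{9L_{xy}^2}{\mu_x(\mu_y+\lambda_y^T)}$. Conventions: $\mathcal O$ hides an absolute constant; each logarithm $\ln s$ inside $\mathcal O(\cdot)$ is read as $\max\{1,\ln s\}$ (so $\ln^2(\kappa)$ means $\max\{1,\ln\kappa\}^2$); the rounding up of the individual sample sizes $n_x^i,n_y^i,N_x,N_y,H_x,H_y$ to integers is disregarded (i.e. these ceilings are dropped). *)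

theory Defs
  imports Complex_Main
begin

(* Constants of a stochastic convex-concave saddle point problem: mu are the strong
   convexity/concavity moduli, L_x, L_y, L_xy the Lipschitz constants of the gradient and
   ell the Lipschitz constants of the function itself. *)
record saddle_params =
  mu_x :: real  mu_y :: real
  L_x :: real  L_y :: real  L_xy :: real
  ell_x :: real  ell_y :: real

definition mu :: "saddle_params \<Rightarrow> real" where
  "mu P = min (mu_x P) (mu_y P)"

definition L :: "saddle_params \<Rightarrow> real" where
  "L P = Max {L_x P, L_y P, L_xy P}"

definition ell :: "saddle_params \<Rightarrow> real" where
  "ell P = max (ell_x P) (ell_y P)"

definition kappa :: "saddle_params \<Rightarrow> real" where
  "kappa P = L P / mu P"

(* Regularization weights. They are indexed by integers because the schedule starts at
   index -1; indices below -1 never occur. *)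
definition lambda_schedule :: "real \<Rightarrow> int \<Rightarrow> real" where
  "lambda_schedule \<mu> i = (if i = -1 then 0 else \<mu> * 2 powi i)"

definition num_rounds :: "saddle_params \<Rightarrow> nat" where
  "num_rounds P =
     nat \<lceil>log 2 (Max {L_x P / mu_x P, L_y P / mu_y P, (L_xy P)\<^sup>2 / (mu_x P * mu_y P)})\<rceil>"

(* In what follows lx and ly are the schedules for x and y and d is the accuracy delta. The
   sample sizes n, N, H are real-valued: they are the expressions under the ceiling in the
   algorithm, since rounding up of individual sample sizes is disregarded. *)

definition n_x :: "saddle_params \<Rightarrow> (int \<Rightarrow> real) \<Rightarrow> real \<Rightarrow> int \<Rightarrow> real" where
  "n_x P lx d i = 54 / d * ((ell_x P)\<^sup>2 / (mu_x P + lx i) + (ell_y P)\<^sup>2 / mu_y P)"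

definition n_y :: "saddle_params \<Rightarrow> (int \<Rightarrow> real) \<Rightarrow> real \<Rightarrow> int \<Rightarrow> real" where
  "n_y P ly d i = 54 / d * ((ell_x P)\<^sup>2 / mu_x P + (ell_y P)\<^sup>2 / (mu_y P + ly i))"

definition M_x :: "saddle_params \<Rightarrow> (int \<Rightarrow> real) \<Rightarrow> nat \<Rightarrow> real" where
  "M_x P lx T = 3 + (18 * sqrt 2 + 45) * ((L_x P + lx (int T)) / (mu_x P + lx (int T)))
     + 36 * L_xy P / sqrt ((mu_x P + lx (int T)) * mu_y P)
     + 9 * (L_xy P)\<^sup>2 / ((mu_x P + lx (int T)) * mu_y P)"

definition M_y :: "saddle_params \<Rightarrow> (int \<Rightarrow> real) \<Rightarrow> nat \<Rightarrow> real" where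
  "M_y P ly T = 3 + (18 * sqrt 2 + 45) * ((L_y P + ly (int T)) / (mu_y P + ly (int T)))
     + 36 * L_xy P / sqrt (mu_x P * (mu_y P + ly (int T)))
     + 9 * (L_xy P)\<^sup>2 / (mu_x P * (mu_y P + ly (int T)))"

definition N_x :: "saddle_params \<Rightarrow> (int \<Rightarrow> real) \<Rightarrow> real \<Rightarrow> nat \<Rightarrow> real" where
  "N_x P lx d T = 6 * M_x P lx T / d
     * ((ell_x P)\<^sup>2 / (mu_x P + lx (int T)) + (ell_y P)\<^sup>2 / mu_y P)"

definition N_y :: "saddle_params \<Rightarrow> (int \<Rightarrow> real) \<Rightarrow> real \<Rightarrow> nat \<Rightarrow> real" where
  "N_y P ly d T = 6 * M_y P ly T / d
     * ((ell_x P)\<^sup>2 / mu_x P + (ell_y P)\<^sup>2 / (mu_y P + ly (int T)))"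

definition sigma2_x :: "saddle_params \<Rightarrow> real" where
  "sigma2_x P = 4 * (ell_x P)\<^sup>2"

definition sigma2_y :: "saddle_params \<Rightarrow> real" where
  "sigma2_y P = 4 * (ell_y P)\<^sup>2"

definition H_x :: "saddle_params \<Rightarrow> (int \<Rightarrow> real) \<Rightarrow> real \<Rightarrow> nat \<Rightarrow> real" where
  "H_x P lx d T = 3 * M_x P lx T * (mu_x P + lx (int T)) * sigma2_x P
     / ((L_x P + lx (int T))\<^sup>2 * d)"

definition H_y :: "saddle_params \<Rightarrow> (int \<Rightarrow> real) \<Rightarrow> real \<Rightarrow> nat \<Rightarrow> real" where
  "H_y P ly d T = 3 * M_y P ly T * (mu_y P + ly (int T)) * sigma2_y P
     / ((L_y P + ly (int T))\<^sup>2 * d)"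

definition num_boosts :: "real \<Rightarrow> nat \<Rightarrow> int" where
  "num_boosts p T =
     (let k = \<lceil>18 * ln ((2 * real T + 6) / p)\<rceil> in if odd k then k else k + 1)"

definition boostSAA_C_samples ::
  "saddle_params \<Rightarrow> (int \<Rightarrow> real) \<Rightarrow> (int \<Rightarrow> real) \<Rightarrow> real \<Rightarrow> real \<Rightarrow> nat \<Rightarrow> real" where
  "boostSAA_C_samples P lx ly d p T =
     real_of_int (num_boosts p T) *
       ((\<Sum>i = 0..T. n_x P lx d (int i - 1) + n_y P ly d (int i - 1))
        + N_x P lx d T + N_y P ly d T + H_x P lx d T + H_y P ly d T)"

(* Reading of a logarithm inside O(.), so that the bound does not degenerate near s = 1. *)
definition ln1 :: "real \<Rightarrow> real" where
  "ln1 s = max 1 (ln s)"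

end

(* The last regularization weight is at least max(L, L_xy^2 / mu) because of the choice of T, so
   the condition numbers of the last round, and with them M_x and M_y, are bounded by an absolute
   constant. Hence all rounds together use O((T + 1) ell^2 / (mu delta)) samples per repetition,
   where 1 / delta = O((T + 1) / epsilon). Finally T = O(ln kappa), since L_xy^2 / (mu_x mu_y) is
   at most kappa^2. *)
theory Submission
  imports Defs
begin

lemma ln1_ge_1: "1 \<le> ln1 s"
  by (simp add: ln1_def)

lemma ln_le_ln1: "ln s \<le> ln1 s"
  by (simp add: ln1_def)

lemma lambda_schedule_nat: "lambda_schedule m (int T) = m * 2 ^ T"
  by (simp add: lambda_schedule_def)

lemma lambda_schedule_nonneg: "0 \<le> m \<Longrightarrow> 0 \<le> lambda_schedule m i"
  by (simp add: lambda_schedule_def)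

text \<open>The weight \<open>m * s\<close> dominates both \<open>l\<close> and
  \<open>c\<^sup>2 / m'\<close>, so the first ratio is at most 2 and the other two are at most 1.
  With \<open>sqrt 2 \<le> 3 / 2\<close> the total is 3 + 144 + 36 + 9 = 192.\<close>

lemma regularized_condition_bound:
  fixes m m' l c s :: real
  assumes "0 < m" "0 < m'" "0 < c" "0 < s" "0 \<le> l" "l \<le> m * s" "c\<^sup>2 \<le> m * m' * s"
  shows "3 + (18 * sqrt 2 + 45) * ((l + m * s) / (m + m * s))
           + 36 * c / sqrt ((m + m * s) * m') + 9 * c\<^sup>2 / ((m + m * s) * m') \<le> 192"
proof -
  have ms: "0 < m * s" and mm: "0 < m * m'" using assms by simp_all
  have "(l + m * s) / (m + m * s) \<le> 2"
    using assms(1,6) ms by (simp add: divide_le_eq)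
  moreover have "sqrt 2 \<le> 3 / 2"
    by (rule real_le_lsqrt) (simp_all add: power2_eq_square)
  ultimately have 1: "(18 * sqrt 2 + 45) * ((l + m * s) / (m + m * s)) \<le> (18 * (3 / 2) + 45) * 2"
    using ms assms(1,5) by (intro mult_mono) auto
  have D: "c\<^sup>2 \<le> (m + m * s) * m'"
    using assms(7) mm by (simp add: algebra_simps)
  have Dp: "0 < (m + m * s) * m'"
    using ms assms by simp
  have "c \<le> sqrt ((m + m * s) * m')"
    using D by (rule real_le_rsqrt)
  hence 2: "36 * c / sqrt ((m + m * s) * m') \<le> 36"
    using Dp by (simp add: divide_le_eq)
  have 3: "9 * c\<^sup>2 / ((m + m * s) * m') \<le> 9"
    using D Dp by (simp add: divide_le_eq)
  show ?thesis
    by (rule order_trans[OF add_mono[OF add_mono[OF add_left_mono[OF 1] 2] 3]]) simp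
qed

text \<open>Serves every SAA sample size of both players: a regularization weight only increases a
  modulus, so \<open>\<mu>\<close> stays a lower bound in all rounds.\<close>

lemma erm_bound:
  fixes a b m m' e \<mu> :: real
  assumes "0 \<le> a" "a \<le> e" "0 \<le> b" "b \<le> e" "0 < \<mu>" "\<mu> \<le> m" "\<mu> \<le> m'"
  shows "a\<^sup>2 / m + b\<^sup>2 / m' \<le> 2 * (e\<^sup>2 / \<mu>)"
proof -
  have "a\<^sup>2 / m \<le> e\<^sup>2 / \<mu>" "b\<^sup>2 / m' \<le> e\<^sup>2 / \<mu>"
    using assms by (auto intro!: frac_le power_mono)
  thus ?thesis by linarith
qed

text \<open>Because \<open>m \<le> l\<close>, one factor \<open>l + s\<close> of the denominator
  absorbs \<open>m + s\<close>, and the remaining \<open>1 / (l + s)\<close> is at most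
  \<open>1 / \<mu>\<close>. The constant is 3 * 4 * 192 = 2304.\<close>

lemma gradient_sample_bound:
  fixes M a d e l m s \<mu> :: real
  assumes "M \<le> 192" "0 \<le> a" "a \<le> e" "0 < d" "0 < \<mu>" "\<mu> \<le> m" "m \<le> l" "0 \<le> s"
  shows "3 * M * (m + s) * (4 * a\<^sup>2) / ((l + s)\<^sup>2 * d) \<le> 2304 / d * (e\<^sup>2 / \<mu>)"
proof -
  have "(m + s) / (l + s)\<^sup>2 \<le> (l + s) / (l + s)\<^sup>2"
    using assms by (intro divide_right_mono) auto
  also have "\<dots> = 1 / (l + s)" by (simp add: power2_eq_square)
  also have "\<dots> \<le> 1 / \<mu>" using assms by (intro frac_le) auto
  finally have 1: "(m + s) / (l + s)\<^sup>2 \<le> 1 / \<mu>" .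
  have a: "a\<^sup>2 \<le> e\<^sup>2" using assms by (intro power_mono)
  have 2: "a\<^sup>2 * ((m + s) / (l + s)\<^sup>2) \<le> e\<^sup>2 * (1 / \<mu>)"
    using assms by (intro mult_mono[OF a 1]) auto
  have 3: "M * (12 / d) \<le> 192 * (12 / d)"
    using assms by (intro mult_right_mono) auto
  \<comment> \<open>\<open>M\<close> has no known sign, so it goes into the first factor:
    \<open>mult_mono\<close> wants only the larger first factor and the smaller second factor to be
    nonnegative.\<close>
  have "(M * (12 / d)) * (a\<^sup>2 * ((m + s) / (l + s)\<^sup>2)) \<le> (192 * (12 / d)) * (e\<^sup>2 * (1 / \<mu>))"
    using assms by (intro mult_mono[OF 3 2]) auto
  thus ?thesis using assms by (simp add: field_simps)
qed

text \<open>Rounding the logarithm up makes \<open>2 ^ num_rounds P\<close> at least each of the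
  three ratios in the maximum; clearing denominators gives what
  \<open>regularized_condition_bound\<close> asks of \<open>s\<close>.\<close>

lemma num_rounds_lower:
  assumes "0 < mu_x P" "0 < mu_y P" "0 < L_x P" "0 < L_y P" "0 < L_xy P"
  shows "L_x P \<le> mu_x P * 2 ^ num_rounds P"
    and "L_y P \<le> mu_y P * 2 ^ num_rounds P"
    and "(L_xy P)\<^sup>2 \<le> mu_x P * mu_y P * 2 ^ num_rounds P"
proof -
  define A where "A = Max {L_x P / mu_x P, L_y P / mu_y P, (L_xy P)\<^sup>2 / (mu_x P * mu_y P)}"
  have le: "L_x P / mu_x P \<le> A" "L_y P / mu_y P \<le> A" "(L_xy P)\<^sup>2 / (mu_x P * mu_y P) \<le> A"
    by (auto simp: A_def)
  have "0 < L_x P / mu_x P" using assms by simp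
  with le(1) have "0 < A" by linarith
  \<comment> \<open>True for a logarithm of either sign, since \<open>nat\<close> only raises
    negative values.\<close>
  have "log 2 A \<le> real (num_rounds P)"
    by (simp add: num_rounds_def A_def real_nat_ceiling_ge)
  hence A: "A \<le> 2 ^ num_rounds P"
    using \<open>0 < A\<close> by (simp add: log_le_iff powr_realpow)
  show "L_x P \<le> mu_x P * 2 ^ num_rounds P"
    using order_trans[OF le(1) A] assms by (simp add: divide_le_eq mult_ac)
  show "L_y P \<le> mu_y P * 2 ^ num_rounds P"
    using order_trans[OF le(2) A] assms by (simp add: divide_le_eq mult_ac)
  show "(L_xy P)\<^sup>2 \<le> mu_x P * mu_y P * 2 ^ num_rounds P"
    using order_trans[OF le(3) A] assms by (simp add: divide_le_eq mult_ac)
qed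

text \<open>All three ratios are at most \<open>(kappa P)\<^sup>2\<close>, hence the binary
  logarithm is at most \<open>4 * ln (kappa P)\<close>; rounding up adds at most 1, which
  \<open>ln1 (kappa P) \<ge> 1\<close> absorbs.\<close>

lemma num_rounds_upper:
  assumes "0 < mu_x P" "0 < mu_y P" "0 < L_xy P" "mu_x P \<le> L_x P" "mu_y P \<le> L_y P"
  shows "real (num_rounds P) \<le> 5 * ln1 (kappa P)"
proof -
  define A where "A = Max {L_x P / mu_x P, L_y P / mu_y P, (L_xy P)\<^sup>2 / (mu_x P * mu_y P)}"
  define k where "k = kappa P"
  have mu: "0 < mu P" "mu P \<le> mu_x P" "mu P \<le> mu_y P"
    using assms by (auto simp: mu_def)
  have L: "L_x P \<le> L P" "L_y P \<le> L P" "L_xy P \<le> L P"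
    by (auto simp: L_def)
  have x: "L_x P / mu_x P \<le> k" and y: "L_y P / mu_y P \<le> k"
    unfolding k_def kappa_def using mu L assms by (auto intro!: frac_le)
  have "1 \<le> L_x P / mu_x P" using assms by simp
  with x have k1: "1 \<le> k" by linarith
  hence kk: "k \<le> k\<^sup>2" by (simp add: power2_eq_square)
  have "(L_xy P)\<^sup>2 / (mu_x P * mu_y P) \<le> (L P)\<^sup>2 / (mu P * mu P)"
    using mu L assms by (intro frac_le mult_mono power_mono) auto
  also have "\<dots> = k\<^sup>2" by (simp add: k_def kappa_def power2_eq_square)
  finally have "A \<le> k\<^sup>2"
    unfolding A_def using x y kk by auto
  have "L_x P / mu_x P \<le> A" by (simp add: A_def)
  with \<open>1 \<le> L_x P / mu_x P\<close> have "1 \<le> A" by linarith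
  have "log 2 A \<le> log 2 (k\<^sup>2)"
    using \<open>A \<le> k\<^sup>2\<close> \<open>1 \<le> A\<close> by (intro log_mono) auto
  also have "\<dots> = 2 * ln k / ln 2"
    using k1 by (simp add: log_def ln_realpow)
  also have "\<dots> \<le> 4 * ln k"
  proof -
    \<comment> \<open>This is \<open>ln 2 \<ge> 1 / 2\<close>, from \<open>ln x \<le> x - 1\<close>
      at \<open>x = 1 / 2\<close>.\<close>
    have "2 \<le> 4 * ln (2::real)"
      using ln_le_minus_one[of "1 / 2"] by (simp add: ln_div)
    from mult_right_mono[OF this, of "ln k"] show ?thesis
      using k1 by (simp add: divide_le_eq mult_ac)
  qed
  finally have "log 2 A \<le> 4 * ln k" .
  \<comment> \<open>\<open>1 \<le> A\<close> makes the ceiling nonnegative, so \<open>nat\<close>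
    does not truncate.\<close>
  moreover have "real (num_rounds P) \<le> log 2 A + 1"
    using \<open>1 \<le> A\<close> unfolding num_rounds_def A_def[symmetric]
    by (intro order_trans[OF _ of_int_ceiling_le_add_one]) (simp add: of_nat_nat)
  ultimately show ?thesis
    using ln_le_ln1[of k] ln1_ge_1[of k] unfolding k_def by linarith
qed

text \<open>\<open>K\<close> stands for \<open>ln1 (kappa P)\<close>. Since
  \<open>2 * T + 6 \<le> 16 * K\<close> and \<open>ln 16 \<le> 4\<close>, the logarithm is at most
  \<open>5 * ln1 (K / p)\<close>, and 92 = 18 * 5 + 2. Nonnegativity allows the bound for one
  repetition to be multiplied by this number.\<close>

lemma num_boosts_bounds:
  assumes "0 < p" "p < 1" "1 \<le> K" "real T \<le> 5 * K"
  shows "0 \<le> num_boosts p T" and "real_of_int (num_boosts p T) \<le> 92 * ln1 (K / p)"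
proof -
  have "1 \<le> (2 * real T + 6) / p" using assms by (simp add: le_divide_eq)
  thus "0 \<le> num_boosts p T"
    unfolding num_boosts_def Let_def
    by (smt (verit, ccfv_SIG) ceiling_mono ceiling_zero ln_ge_zero)
  have "(2 * real T + 6) / p \<le> 16 * (K / p)"
    using assms by (simp add: divide_right_mono)
  hence "ln ((2 * real T + 6) / p) \<le> ln (16 * (K / p))"
    using assms by (intro ln_mono) auto
  also have "\<dots> = ln (2 ^ 4) + ln (K / p)"
    using assms by (subst ln_mult_pos) auto
  also have "\<dots> \<le> 4 + ln (K / p)"
    using ln_le_minus_one[of 2] by (simp only: ln_realpow) simp
  finally have "ln ((2 * real T + 6) / p) \<le> 5 * ln1 (K / p)"
    using ln_le_ln1[of "K / p"] ln1_ge_1[of "K / p"] by linarith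
  \<comment> \<open>One unit is lost to the ceiling and one to making the number odd.\<close>
  moreover have "real_of_int (num_boosts p T) \<le> 18 * ln ((2 * real T + 6) / p) + 2"
    unfolding num_boosts_def Let_def by auto linarith+
  ultimately show "real_of_int (num_boosts p T) \<le> 92 * ln1 (K / p)"
    using ln1_ge_1[of "K / p"] by linarith
qed

text \<open>In units of \<open>(ell P)\<^sup>2 / (mu P * d)\<close>, each of the
  \<open>T + 1\<close> rounds costs at most 2 * 54 * 2 = 216 and each of the four last terms at most
  6 * 192 * 2 = 2304. Enlarging 4 * 2304 = 9216 by the factor \<open>1 + T\<close> gives 216 + 9216
  = 9432.\<close>

lemma samples_per_repetition_bound:
  assumes "0 < mu_x P" "0 < mu_y P" "0 < L_xy P" "0 < ell_x P" "0 < ell_y P"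
    and "mu_x P \<le> L_x P" "mu_y P \<le> L_y P" and d: "0 < d"
  defines "T \<equiv> num_rounds P"
    and "lx \<equiv> lambda_schedule (mu_x P)" and "ly \<equiv> lambda_schedule (mu_y P)"
  shows "(\<Sum>i = 0..T. n_x P lx d (int i - 1) + n_y P ly d (int i - 1))
           + N_x P lx d T + N_y P ly d T + H_x P lx d T + H_y P ly d T
         \<le> 9432 * (1 + real T) * ((ell P)\<^sup>2 / mu P) / d"
proof -
  define Q where "Q = (ell P)\<^sup>2 / mu P"
  have mu: "0 < mu P" "mu P \<le> mu_x P" "mu P \<le> mu_y P"
    using assms by (auto simp: mu_def)
  have ell: "ell_x P \<le> ell P" "ell_y P \<le> ell P" by (auto simp: ell_def)
  have Q0: "0 \<le> Q" using mu by (simp add: Q_def)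
  have lx: "0 \<le> lx i" and ly: "0 \<le> ly i" for i
    unfolding lx_def ly_def using assms by (auto intro!: lambda_schedule_nonneg)
  have Bx: "(ell_x P)\<^sup>2 / (mu_x P + lx i) + (ell_y P)\<^sup>2 / mu_y P \<le> 2 * Q" for i
    unfolding Q_def using assms(4,5) mu ell lx[of i] by (intro erm_bound) auto
  have By: "(ell_x P)\<^sup>2 / mu_x P + (ell_y P)\<^sup>2 / (mu_y P + ly i) \<le> 2 * Q" for i
    unfolding Q_def using assms(4,5) mu ell ly[of i] by (intro erm_bound) auto
  \<comment> \<open>Nonnegativity lets the bounds on these sums be multiplied with those on
    \<open>M_x\<close> and \<open>M_y\<close>.\<close>
  have nonneg_x: "0 \<le> (ell_x P)\<^sup>2 / (mu_x P + lx i) + (ell_y P)\<^sup>2 / mu_y P"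
    and nonneg_y: "0 \<le> (ell_x P)\<^sup>2 / mu_x P + (ell_y P)\<^sup>2 / (mu_y P + ly i)" for i
    using assms(1,2) lx[of i] ly[of i] by (auto intro!: add_nonneg_nonneg divide_nonneg_pos)
  have L: "0 < L_x P" "0 < L_y P" using assms by linarith+
  note low = num_rounds_lower[OF assms(1,2) L assms(3), folded T_def]
  have Mx: "M_x P lx T \<le> 192"
    unfolding M_x_def lx_def lambda_schedule_nat
    using assms(1-3) L low by (intro regularized_condition_bound) auto
  \<comment> \<open>The same bound with the players exchanged; \<open>M_y\<close> has
    \<open>mu_x P\<close> on the left in its denominators, so the factors are reordered
    afterwards.\<close>
  have "3 + (18 * sqrt 2 + 45) * ((L_y P + mu_y P * 2 ^ T) / (mu_y P + mu_y P * 2 ^ T))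
      + 36 * L_xy P / sqrt ((mu_y P + mu_y P * 2 ^ T) * mu_x P)
      + 9 * (L_xy P)\<^sup>2 / ((mu_y P + mu_y P * 2 ^ T) * mu_x P) \<le> 192"
    using assms(1-3) L low by (intro regularized_condition_bound) (auto simp: mult_ac)
  hence My: "M_y P ly T \<le> 192"
    unfolding M_y_def ly_def lambda_schedule_nat by (simp only: mult.commute[of _ "mu_x P"])
  have nx: "n_x P lx d i \<le> 108 * Q / d" for i
    using mult_left_mono[OF Bx, of "54 / d" i] d by (simp add: n_x_def)
  have ny: "n_y P ly d i \<le> 108 * Q / d" for i
    using mult_left_mono[OF By, of "54 / d" i] d by (simp add: n_y_def)
  have "(\<Sum>i = 0..T. n_x P lx d (int i - 1) + n_y P ly d (int i - 1))
      \<le> (\<Sum>i = 0..T. 216 * Q / d)"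
  proof (rule sum_mono)
    fix i
    show "n_x P lx d (int i - 1) + n_y P ly d (int i - 1) \<le> 216 * Q / d"
      using add_mono[OF nx[of "int i - 1"] ny[of "int i - 1"]] by simp
  qed
  hence S: "(\<Sum>i = 0..T. n_x P lx d (int i - 1) + n_y P ly d (int i - 1))
      \<le> 216 * (1 + real T) * (Q / d)"
    by (simp add: algebra_simps add_divide_distrib)
  have Nx: "N_x P lx d T \<le> 2304 * (Q / d)"
  proof -
    have "N_x P lx d T \<le> (6 * 192 / d) * (2 * Q)"
      unfolding N_x_def using d
      by (intro mult_mono[OF _ Bx _ nonneg_x]) (auto intro!: divide_right_mono Mx)
    thus ?thesis by simp
  qed
  have Ny: "N_y P ly d T \<le> 2304 * (Q / d)"
  proof -
    have "N_y P ly d T \<le> (6 * 192 / d) * (2 * Q)"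
      unfolding N_y_def using d
      by (intro mult_mono[OF _ By _ nonneg_y]) (auto intro!: divide_right_mono My)
    thus ?thesis by simp
  qed
  have "H_x P lx d T \<le> 2304 / d * Q"
    unfolding H_x_def sigma2_x_def Q_def
    using Mx d mu ell lx assms by (intro gradient_sample_bound) auto
  hence Hx: "H_x P lx d T \<le> 2304 * (Q / d)" by simp
  have "H_y P ly d T \<le> 2304 / d * Q"
    unfolding H_y_def sigma2_y_def Q_def
    using My d mu ell ly assms by (intro gradient_sample_bound) auto
  hence Hy: "H_y P ly d T \<le> 2304 * (Q / d)" by simp
  have "9216 * (Q / d) \<le> 9216 * (1 + real T) * (Q / d)"
    using Q0 d by (intro mult_right_mono) auto
  hence "(\<Sum>i = 0..T. n_x P lx d (int i - 1) + n_y P ly d (int i - 1))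
      + N_x P lx d T + N_y P ly d T + H_x P lx d T + H_y P ly d T
      \<le> 216 * (1 + real T) * (Q / d) + 9216 * (1 + real T) * (Q / d)"
    using S Nx Ny Hx Hy by linarith
  also have "\<dots> = 9432 * (1 + real T) * Q / d" by (simp add: algebra_simps add_divide_distrib)
  finally show ?thesis unfolding Q_def .
qed

theorem mainTheorem10:
  "\<exists>C::real. C > 0 \<and> (\<forall>(P :: saddle_params) (\<epsilon> :: real) (p :: real).
     \<epsilon> > 0 \<longrightarrow> 0 < p \<longrightarrow> p < 1 \<longrightarrow>
     mu_x P > 0 \<longrightarrow> mu_y P > 0 \<longrightarrow> L_x P > 0 \<longrightarrow> L_y P > 0 \<longrightarrow> L_xy P > 0 \<longrightarrow>
     ell_x P > 0 \<longrightarrow> ell_y P > 0 \<longrightarrow> mu_x P \<le> L_x P \<longrightarrow> mu_y P \<le> L_y P \<longrightarrow>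
     (let T = num_rounds P;
          \<delta> = \<epsilon> / (4 + 4 * real T);
          lx = lambda_schedule (mu_x P);
          ly = lambda_schedule (mu_y P)
      in boostSAA_C_samples P lx ly \<delta> p T
           \<le> C * ((ln1 (kappa P))\<^sup>2 * ln1 (ln1 (kappa P) / p) * ((ell P)\<^sup>2 / (mu P * \<epsilon>)))))"
proof (rule exI[of _ "92 * 1358208"], intro conjI allI impI, goal_cases)
  case 1
  show ?case by simp
next
  case (2 P \<epsilon> p)
  define T where "T = num_rounds P"
  define \<delta> where "\<delta> = \<epsilon> / (4 + 4 * real T)"
  define K where "K = ln1 (kappa P)"
  define S where "S = (\<Sum>i = 0..T. n_x P (lambda_schedule (mu_x P)) \<delta> (int i - 1)
        + n_y P (lambda_schedule (mu_y P)) \<delta> (int i - 1))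
      + N_x P (lambda_schedule (mu_x P)) \<delta> T + N_y P (lambda_schedule (mu_y P)) \<delta> T
      + H_x P (lambda_schedule (mu_x P)) \<delta> T + H_y P (lambda_schedule (mu_y P)) \<delta> T"
  have mu: "0 < mu P" using 2 by (simp add: mu_def)
  have K: "1 \<le> K" by (simp add: K_def ln1_ge_1)
  have T: "real T \<le> 5 * K" unfolding T_def K_def using 2 by (intro num_rounds_upper)
  have \<delta>: "0 < \<delta>" using 2 by (simp add: \<delta>_def)
  note m = num_boosts_bounds[OF 2(2,3) K T]
  have "(1 + real T)\<^sup>2 \<le> (6 * K)\<^sup>2" using K T by (intro power_mono) auto
  hence T2: "(1 + real T)\<^sup>2 \<le> 36 * K\<^sup>2" by (simp add: power_mult_distrib)
  have "S \<le> 9432 * (1 + real T) * ((ell P)\<^sup>2 / mu P) / \<delta>"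
    unfolding S_def T_def using 2 \<delta> by (intro samples_per_repetition_bound) auto
  \<comment> \<open>\<open>1 / \<delta>\<close> equals \<open>4 * (1 + T) / \<epsilon>\<close>,
    which supplies the second factor \<open>1 + T\<close>. With \<open>1 + T \<le> 6 * K\<close> the
    constant becomes 9432 * 4 * 36 = 1358208; the factor 92 of the witness comes from the number of
    repetitions.\<close>
  also have "\<dots> = 37728 * (1 + real T)\<^sup>2 * ((ell P)\<^sup>2 / (mu P * \<epsilon>))"
    using 2(1) mu by (simp add: \<delta>_def power2_eq_square field_simps)
  also have "\<dots> \<le> 37728 * (36 * K\<^sup>2) * ((ell P)\<^sup>2 / (mu P * \<epsilon>))"
    using T2 2(1) mu by (intro mult_right_mono) auto
  finally have S: "S \<le> 1358208 * K\<^sup>2 * ((ell P)\<^sup>2 / (mu P * \<epsilon>))" by simp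
  have "real_of_int (num_boosts p T) * S
      \<le> real_of_int (num_boosts p T) * (1358208 * K\<^sup>2 * ((ell P)\<^sup>2 / (mu P * \<epsilon>)))"
    using S m(1) by (intro mult_left_mono) auto
  also have "\<dots> \<le> 92 * ln1 (K / p) * (1358208 * K\<^sup>2 * ((ell P)\<^sup>2 / (mu P * \<epsilon>)))"
    using m(2) 2(1) mu by (intro mult_right_mono) auto
  finally have "real_of_int (num_boosts p T) * S
      \<le> 92 * 1358208 * (K\<^sup>2 * ln1 (K / p) * ((ell P)\<^sup>2 / (mu P * \<epsilon>)))"
    by (simp add: mult_ac)
  thus ?case
    by (simp only: Let_def boostSAA_C_samples_def S_def K_def T_def \<delta>_def)
qed

end
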